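(* Let $j \in \mathbb{N}_0$ and $r \in \mathbb{Z}$. Then, pointwise on $\mathbb{N}$, $$d_r = \sum_{k=0}^{\infty} \binom{k+r-1}{k} c_k^{(-k)}.$$ More generally, for any $u \in \mathbb{N}_0$ and $v \in \mathbb{Z}$, $$c_{j+u}^{(r+v)} = \sum_{k=j}^{\infty} \binom{k+r-1}{k-j} c_{u+k}^{(v-k)}.$$
   Context: Arithmetic functions are maps $\mathbb{N} \to \mathbb{C}$ with Dirichlet convolution $(f*g)(n) = \sum_{n_1 n_2 = n} f(n_1) g(n_2)$. Write $f^{*j}$ for the $j$-fold convolution power, with $f^{*0} = e$, where $e(n) = \delta_{n,1}$. Let $1$ denote the constant function $1$ and $\mu$ the Möbius function; for negative integers $-r$ set $1^{*(-r)} = \mu^{*r}$. The divisor function $d_r$ is $d_r = 1^{*r}$ for $r \in \mathbb{Z}$. For $j \in \mathbb{N}_0$, $r \in \mathbb{Z}$, the associated divisor function is $c_j^{(r)} = (1-e)^{*j} * 1^{*r}$. Binomial coefficients with integer (possibly negative) upper entry are the generalized ones $\binom{x}{a} = x(x-1)\cdots(x-a+1)/a!$ for $a\in\mathbb{N}_0$. For each fixed $n$ only finitely many terms of the series are nonzero. *)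

theory Defs
  imports "HOL-Analysis.Analysis" "HOL-Computational_Algebra.Squarefree"
begin

text \<open>
  Arithmetic functions are rendered as total functions on \<^typ>\<open>nat\<close>. Only their values at
  positive arguments are meaningful: for \<open>n > 0\<close> both factors in \<open>n\<^sub>1 * n\<^sub>2 = n\<close> are positive,
  so the values at \<open>0\<close> never enter a convolution. At \<open>n = 0\<close> the index set is infinite and the
  convolution is \<open>0\<close> by the convention for sums.
\<close>

type_synonym arith_fun = "nat \<Rightarrow> complex"

definition dirichlet_conv :: "arith_fun \<Rightarrow> arith_fun \<Rightarrow> arith_fun" (infixl "\<star>" 70) where
  "f \<star> g = (\<lambda>n. \<Sum>(n1, n2) \<in> {(n1, n2). n1 * n2 = n}. f n1 * g n2)"

definition conv_unit :: arith_fun where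
  "conv_unit = (\<lambda>n. if n = 1 then 1 else 0)"

definition const_one :: arith_fun where
  "const_one = (\<lambda>n. 1)"

definition moebius :: arith_fun where
  "moebius = (\<lambda>n. if squarefree n then (- 1) ^ card (prime_factors n) else 0)"

primrec conv_power :: "arith_fun \<Rightarrow> nat \<Rightarrow> arith_fun" where
  "conv_power f 0 = conv_unit"
| "conv_power f (Suc k) = f \<star> conv_power f k"

definition one_conv_power :: "int \<Rightarrow> arith_fun" where
  "one_conv_power r =
     (if r \<ge> 0 then conv_power const_one (nat r) else conv_power moebius (nat (- r)))"

definition divisor_fun :: "int \<Rightarrow> arith_fun" where
  "divisor_fun r = one_conv_power r"

definition assoc_divisor_fun :: "nat \<Rightarrow> int \<Rightarrow> arith_fun" where
  "assoc_divisor_fun j r = conv_power (\<lambda>n. const_one n - conv_unit n) j \<star> one_conv_power r"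

end

theory Submission
  imports Defs
begin

text \<open>
  In the ring of arithmetic functions put \<open>x = (1 - e) * \<mu> = e - \<mu>\<close>, so that \<open>1 = (e - x)\<^sup>-\<^sup>1\<close> and
  \<open>c\<^sub>u\<^sub>+\<^sub>k\<^sup>(\<^sup>v\<^sup>-\<^sup>k\<^sup>) = c\<^sub>u\<^sup>(\<^sup>v\<^sup>) * x\<^sup>k\<close>. Since \<open>x\<^sup>k\<close> is supported on \<open>n \<ge> 2\<^sup>k\<close>, the statement is the binomial
  series for \<open>(e - x)\<^sup>-\<^sup>s\<close>, which follows from Pascal's rule by induction on the integer \<open>s\<close> in both
  directions, each step multiplying by \<open>1\<close> or by \<open>\<mu> = e - x\<close>. For the general identity one shifts
  the summation index by \<open>j\<close> and takes \<open>s = j + r\<close>.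
\<close>

section \<open>The ring of arithmetic functions\<close>

lemma finite_factorizations:
  assumes "(n::nat) > 0"
  shows "finite {(a, b). a * b = n}"
proof (rule finite_subset)
  show "{(a, b). a * b = n} \<subseteq> {..n} \<times> {..n}"
    using assms by auto
qed auto

text \<open>Every \<open>b\<close> satisfies \<open>0 * b = 0\<close>, so the index set is infinite
  and the sum takes its default value 0.\<close>

lemma dirichlet_conv_0 [simp]: "(f \<star> g) 0 = 0"
proof -
  have "infinite {(a, b). a * b = (0::nat)}"
  proof
    assume "finite {(a, b). a * b = (0::nat)}"
    then have "finite (snd ` {(a, b). a * b = (0::nat)})" by (rule finite_imageI)
    moreover have "snd ` {(a, b). a * b = (0::nat)} = UNIV"
      by (force simp: image_iff)
    ultimately show False by simp
  qed
  then show ?thesis by (simp add: dirichlet_conv_def)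
qed

lemma dirichlet_conv_commute: "f \<star> g = g \<star> f"
  unfolding dirichlet_conv_def
  by (rule ext, rule sum.reindex_bij_witness[of _ prod.swap prod.swap]) (auto simp: mult.commute)

text \<open>Both sides run over the triples with product \<open>n\<close>, coded as a pair together
  with a splitting of its first or its second entry.\<close>

lemma dirichlet_conv_assoc: "(f \<star> g) \<star> h = f \<star> (g \<star> h)"
proof
  fix n :: nat
  show "((f \<star> g) \<star> h) n = (f \<star> (g \<star> h)) n"
  proof (cases "n = 0")
    case False
    let ?D = "\<lambda>m::nat. {(a, b). a * b = m}"
    have pos: "a > 0 \<and> b > 0" if "(a, b) \<in> ?D n" for a b
      using that False by auto
    have "((f \<star> g) \<star> h) n = (\<Sum>p\<in>?D n. \<Sum>q\<in>?D (fst p). f (fst q) * g (snd q) * h (snd p))"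
      by (simp add: dirichlet_conv_def case_prod_unfold sum_distrib_right)
    also have "\<dots> = (\<Sum>(p, q)\<in>Sigma (?D n) (\<lambda>p. ?D (fst p)). f (fst q) * g (snd q) * h (snd p))"
      using False pos by (intro sum.Sigma finite_factorizations ballI) auto
    also have "\<dots> = (\<Sum>(p, q)\<in>Sigma (?D n) (\<lambda>p. ?D (snd p)). f (fst p) * (g (fst q) * h (snd q)))"
      by (rule sum.reindex_bij_witness[of _
            "\<lambda>((a, _), (b, c)). ((a * b, c), (a, b))" "\<lambda>((_, c), (a, b)). ((a, b * c), (b, c))"])
        (auto simp: mult.assoc)
    also have "\<dots> = (\<Sum>p\<in>?D n. \<Sum>q\<in>?D (snd p). f (fst p) * (g (fst q) * h (snd q)))"
      using False pos by (intro sum.Sigma[symmetric] finite_factorizations ballI) auto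
    also have "\<dots> = (f \<star> (g \<star> h)) n"
      by (simp add: dirichlet_conv_def case_prod_unfold sum_distrib_left)
    finally show ?thesis .
  qed simp
qed

lemma dirichlet_conv_unit:
  assumes "n > 0"
  shows "(conv_unit \<star> f) n = f n"
proof -
  have "(conv_unit \<star> f) n = (\<Sum>(a, b)\<in>{(a, b). a * b = n}. if a = 1 then f b else 0)"
    by (auto simp: dirichlet_conv_def conv_unit_def intro!: sum.cong)
  also have "\<dots> = (\<Sum>(a, b)\<in>{(1::nat, n)}. if a = 1 then f b else 0)"
    using assms by (intro sum.mono_neutral_right finite_factorizations) (auto split: if_splits)
  finally show ?thesis by simp
qed

lemma dirichlet_conv_cong:
  assumes "\<And>m. m > 0 \<Longrightarrow> f m = f' m" "\<And>m. m > 0 \<Longrightarrow> g m = g' m"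
  shows "f \<star> g = f' \<star> g'"
proof
  fix n :: nat
  show "(f \<star> g) n = (f' \<star> g') n"
  proof (cases "n = 0")
    case False
    have "f a * g b = f' a * g' b" if "a * b = n" for a b
      using False that by (intro arg_cong2[of _ _ _ _ "(*)"] assms) auto
    then show ?thesis
      unfolding dirichlet_conv_def by (auto intro!: sum.cong)
  qed simp
qed

text \<open>
  The convolution vanishes at \<open>0\<close>, so normalising all functions to vanish there turns the
  convolution unit into a genuine unit.
\<close>

typedef arith = "{f :: arith_fun. f 0 = 0}" morphisms arith_val Arith
  by (rule exI[of _ "\<lambda>_. 0"]) simp

setup_lifting type_definition_arith

instantiation arith :: comm_ring_1
begin

lift_definition zero_arith :: arith is "\<lambda>_. 0" by simp
lift_definition one_arith :: arith is conv_unit by (simp add: conv_unit_def)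
lift_definition plus_arith :: "arith \<Rightarrow> arith \<Rightarrow> arith" is "\<lambda>f g n. f n + g n" by simp
lift_definition minus_arith :: "arith \<Rightarrow> arith \<Rightarrow> arith" is "\<lambda>f g n. f n - g n" by simp
lift_definition uminus_arith :: "arith \<Rightarrow> arith" is "\<lambda>f n. - f n" by simp
lift_definition times_arith :: "arith \<Rightarrow> arith \<Rightarrow> arith" is "(\<star>)" by simp

instance
proof
  fix f g h :: arith
  show "f * g * h = f * (g * h)"
    by transfer (rule dirichlet_conv_assoc)
  show "f * g = g * f"
    by transfer (rule dirichlet_conv_commute)
  show "1 * f = f"
    by transfer (metis ext dirichlet_conv_0 dirichlet_conv_unit gr0I)
  show "(f + g) * h = f * h + g * h"
    by transfer (simp add: dirichlet_conv_def case_prod_unfold distrib_right sum.distrib)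
  show "(0::arith) \<noteq> 1"
    by transfer (auto simp: conv_unit_def fun_eq_iff)
qed (transfer; simp add: algebra_simps)+

end

text \<open>Resets the value at 0, so that convolution identities become identities in a commutative
  ring.\<close>

lift_definition arith_of :: "arith_fun \<Rightarrow> arith" is "\<lambda>f n. if n = 0 then 0 else f n" by simp

lemma arith_val_arith_of: "n > 0 \<Longrightarrow> arith_val (arith_of f) n = f n"
  by transfer simp

lemma arith_of_conv [simp]: "arith_of (f \<star> g) = arith_of f * arith_of g"
proof (transfer, rule ext)
  fix f g :: arith_fun and n
  show "(if n = 0 then 0 else (f \<star> g) n)
      = ((\<lambda>n. if n = 0 then 0 else f n) \<star> (\<lambda>n. if n = 0 then 0 else g n)) n"
    using fun_cong[OF dirichlet_conv_cong[of f "\<lambda>n. if n = 0 then 0 else f n" g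
        "\<lambda>n. if n = 0 then 0 else g n"], of n] by auto
qed

lemma arith_of_unit [simp]: "arith_of conv_unit = 1"
  by transfer (auto simp: conv_unit_def)

lemma arith_of_diff [simp]: "arith_of (\<lambda>n. f n - g n) = arith_of f - arith_of g"
  by transfer auto

lemma arith_of_conv_power [simp]: "arith_of (conv_power f k) = arith_of f ^ k"
  by (induction k) simp_all

section \<open>Moebius inversion\<close>

text \<open>Multiplying by a new prime does not affect squarefreeness and adds one prime factor,
  which flips the sign; if \<open>d\<close> is not squarefree, both sides are 0.\<close>

lemma moebius_prime_mult:
  assumes p: "prime p" and d: "\<not> p dvd d" and "d > 0"
  shows "moebius (p * d) = - moebius d"
proof -
  have cop: "coprime p d"
    using p d by (simp add: prime_imp_coprime)
  have "squarefree (p * d) \<longleftrightarrow> squarefree d"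
    using cop p by (auto intro: squarefree_mult_coprime squarefree_prime dest: squarefree_multD)
  moreover have "prime_factors (p * d) = insert p (prime_factors d)"
    using p \<open>d > 0\<close> by (auto simp: prime_factors_product prime_prime_factors)
  moreover have "p \<notin> prime_factors d" using d by auto
  ultimately show ?thesis
    by (simp add: moebius_def)
qed

text \<open>For a prime \<open>p\<close> dividing \<open>n\<close>, the terms at \<open>d\<close>
  and \<open>p * d\<close> with \<open>p\<close> not dividing \<open>d\<close> cancel, and multiples
  of the square of \<open>p\<close> contribute 0.\<close>

lemma sum_moebius_divisors:
  assumes "n > 1"
  shows "(\<Sum>d | d dvd n. moebius d) = 0"
proof -
  obtain p where p: "prime p" "p dvd n"
    using assms prime_factor_nat[of n] by auto
  let ?A = "{d. p * d dvd n \<and> \<not> p dvd d}"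
  have fin: "finite {d. d dvd n}" using assms by simp
  have "?A \<subseteq> {d. d dvd n}"
    using dvd_mult_right by blast
  then have finA: "finite ?A" using fin finite_subset by blast
  have sub: "?A \<union> (*) p ` ?A \<subseteq> {d. d dvd n}"
    using dvd_mult_right by blast
  have "(\<Sum>d | d dvd n. moebius d) = (\<Sum>d\<in>?A \<union> (*) p ` ?A. moebius d)"
  proof (rule sum.mono_neutral_right[OF fin sub], rule ballI)
    fix d assume "d \<in> {d. d dvd n} - (?A \<union> (*) p ` ?A)"
    then have d: "d dvd n" "d \<notin> (*) p ` ?A" and nz: "\<not> p * d dvd n \<or> p dvd d"
      by auto
    have "p dvd d"
    proof (rule ccontr)
      assume "\<not> p dvd d"
      then have "coprime p d" using p by (simp add: prime_imp_coprime)
      then have "p * d dvd n" using p d by (simp add: divides_mult)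
      with nz \<open>\<not> p dvd d\<close> show False by simp
    qed
    then obtain e where e: "d = p * e" by blast
    \<comment> \<open>If \<open>p\<close> did not divide \<open>e\<close>, then \<open>e\<close>
      would lie in \<open>?A\<close> and \<open>d\<close> in its image.\<close>
    with d have "p dvd e" by auto
    with e have "p\<^sup>2 dvd d" by (simp add: power2_eq_square)
    then have "\<not> squarefree d"
      using p not_prime_unit squarefreeD by blast
    then show "moebius d = 0" by (simp add: moebius_def)
  qed
  also have "\<dots> = (\<Sum>d\<in>?A. moebius d) + (\<Sum>d\<in>(*) p ` ?A. moebius d)"
    using finA by (intro sum.union_disjoint) auto
  also have "(\<Sum>d\<in>(*) p ` ?A. moebius d) = (\<Sum>d\<in>?A. moebius (p * d))"
    using p by (intro sum.reindex[unfolded o_def]) (auto simp: inj_on_def)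
  also have "\<dots> = (\<Sum>d\<in>?A. - moebius d)"
    using p assms by (intro sum.cong refl moebius_prime_mult) (auto intro!: Nat.gr0I)
  finally show ?thesis by (simp add: sum_negf)
qed

lemma moebius_conv_one: "arith_of moebius * arith_of const_one = 1"
proof -
  have "(moebius \<star> const_one) n = conv_unit n" if "n > 0" for n
  proof -
    have "(moebius \<star> const_one) n = (\<Sum>d | d dvd n. moebius d)"
      unfolding dirichlet_conv_def const_one_def
      using that
      by (intro sum.reindex_bij_witness[of _ "\<lambda>d. (d, n div d)" fst]) auto
    also have "\<dots> = conv_unit n"
    proof (cases "n = 1")
      case True
      then show ?thesis by (simp add: moebius_def conv_unit_def)
    next
      case False
      then show ?thesis using that sum_moebius_divisors[of n] by (simp add: conv_unit_def)
    qed
    finally show ?thesis .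
  qed
  then have "arith_of (moebius \<star> const_one) = arith_of conv_unit"
    by transfer auto
  then show ?thesis by simp
qed

section \<open>Integer convolution powers of the constant function 1\<close>

lemma one_conv_power_succ:
  "arith_of (one_conv_power (r + 1)) = arith_of const_one * arith_of (one_conv_power r)"
proof (cases "r \<ge> 0")
  case True
  then have "nat (r + 1) = Suc (nat r)" by simp
  with True show ?thesis by (simp add: one_conv_power_def)
next
  case False
  then have "nat (- r) = Suc (nat (- (r + 1)))" by simp
  with False have "arith_of (one_conv_power r)
      = arith_of moebius * arith_of moebius ^ nat (- (r + 1))"
    by (simp add: one_conv_power_def)
  \<comment> \<open>At \<open>r = -1\<close> the left side switches to the nonnegative branch of the
    definition; both powers are then the unit.\<close>
  moreover have "arith_of (one_conv_power (r + 1)) = arith_of moebius ^ nat (- (r + 1))"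
    using False by (cases "r = -1") (auto simp: one_conv_power_def)
  ultimately show ?thesis
    using moebius_conv_one by (metis mult.commute mult.left_commute mult_1)
qed

lemma one_conv_power_pred:
  "arith_of (one_conv_power (r - 1)) = arith_of moebius * arith_of (one_conv_power r)"
  using one_conv_power_succ[of "r - 1"] moebius_conv_one
  by (metis diff_add_cancel mult.assoc mult_1)

lemma one_conv_power_0 [simp]: "arith_of (one_conv_power 0) = 1"
  by (simp add: one_conv_power_def)

lemma one_conv_power_add:
  "arith_of (one_conv_power (r + s)) = arith_of (one_conv_power r) * arith_of (one_conv_power s)"
proof (induction s rule: int_induct[of _ 0])
  case (step1 i)
  then show ?case
    using one_conv_power_succ[of "r + i"] one_conv_power_succ[of i] by (simp add: add.assoc mult_ac)
next
  case (step2 i)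
  then show ?case
    using one_conv_power_pred[of "r + i"] one_conv_power_pred[of i]
    by (simp add: add_diff_eq mult_ac)
qed simp

lemma one_conv_power_diff_nat:
  "arith_of (one_conv_power (r - int k)) = arith_of (one_conv_power r) * arith_of moebius ^ k"
proof (induction k)
  case (Suc k)
  have "r - int (Suc k) = r - int k - 1" by simp
  then show ?case
    using Suc one_conv_power_pred[of "r - int k"] by (simp only: power_Suc mult_ac)
qed simp

section \<open>The binomial series\<close>

text \<open>If \<open>k * l = n < b * c\<close>, then \<open>k < b\<close> or \<open>l < c\<close>,
  so every summand has a vanishing factor.\<close>

lemma arith_val_mult_eq_0:
  assumes "\<And>m. m < b \<Longrightarrow> arith_val f m = 0" "\<And>m. m < c \<Longrightarrow> arith_val g m = 0" and "n < b * c"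
  shows "arith_val (f * g) n = 0"
proof -
  have "arith_val f k * arith_val g l = 0" if "k * l = n" for k l
  proof (cases "k < b")
    case False
    then have "l < c" using that assms(3) by (metis mult_le_mono not_le)
    then show ?thesis using assms(2) by simp
  qed (simp add: assms(1))
  then show ?thesis
    by (auto simp: times_arith.rep_eq dirichlet_conv_def intro!: sum.neutral)
qed

text \<open>As \<open>x\<close> vanishes below 2, the bound doubles with each factor
  \<open>x\<close>.\<close>

lemma arith_val_power_eq_0:
  assumes "arith_val x 1 = 0" and "n < 2 ^ k"
  shows "arith_val (x ^ k) n = 0"
  using assms(2)
proof (induction k arbitrary: n)
  case 0
  then show ?case by (simp add: one_arith.rep_eq conv_unit_def)
next
  case (Suc k)
  have "arith_val x m = 0" if "m < 2" for m
    using that assms(1) arith_val[of x] by (auto simp: less_2_cases_iff)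
  then show ?case
    unfolding power_Suc using Suc by (intro arith_val_mult_eq_0[of 2 _ "2 ^ k"]) auto
qed

text \<open>Any \<open>f\<close> in the ring vanishes at 0, that is, below 1, so the bound for
  \<open>x ^ k\<close> persists.\<close>

lemma arith_val_mult_power_eq_0:
  assumes "arith_val x 1 = 0" and "n < 2 ^ k"
  shows "arith_val (f * x ^ k) n = 0"
  using assms arith_val[of f] by (intro arith_val_mult_eq_0[of 1 _ "2 ^ k"] arith_val_power_eq_0) auto

text \<open>Truncated binomial series of \<open>f\<close> times the inverse \<open>s\<close>-th
  power of \<open>1 - x\<close>. Truncating keeps the induction on \<open>s\<close> within finite
  sums.\<close>

definition binomial_partial :: "arith \<Rightarrow> arith \<Rightarrow> int \<Rightarrow> nat \<Rightarrow> nat \<Rightarrow> complex" where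
  "binomial_partial x f s N n =
     (\<Sum>k<N. ((of_int (int k + s - 1) :: complex) gchoose k) * arith_val (f * x ^ k) n)"

text \<open>For positive \<open>k\<close> the upper entry \<open>k - 1\<close> is a natural number
  below \<open>k\<close>, giving 0, while the term \<open>k = 0\<close> has coefficient 1.\<close>

lemma binomial_partial_0:
  assumes "N > 0"
  shows "binomial_partial x f 0 N n = arith_val f n"
proof -
  have "(of_int (int k - 1) :: complex) gchoose k = (if k = 0 then 1 else 0)" for k
    by (cases k) (simp_all flip: binomial_gbinomial)
  then show ?thesis
    using assms by (simp add: binomial_partial_def if_distrib[of "\<lambda>c. c * _"] cong: if_cong)
qed

text \<open>Multiplying by \<open>1 - x\<close> produces differences of neighbouring coefficients
  for \<open>s + 1\<close>, which Pascal's rule turns into those for \<open>s\<close>.\<close>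

lemma binomial_partial_step:
  assumes "arith_val x 1 = 0" and "n < 2 ^ N"
  shows "binomial_partial x (f * (1 - x)) (s + 1) (Suc N) n = binomial_partial x f s (Suc N) n"
proof -
  let ?b = "\<lambda>s k. (of_int (int k + s - 1) :: complex) gchoose k"
  let ?v = "\<lambda>k. arith_val (f * x ^ k) n"
  have pascal: "?b (s + 1) (Suc k) - ?b (s + 1) k = ?b s (Suc k)" for k
    using gbinomial_Suc_Suc[of "of_int (int k + s) :: complex" k] by (simp add: algebra_simps)
  have "f * (1 - x) * x ^ k = f * x ^ k - f * x ^ Suc k" for k
    by (simp add: algebra_simps)
  then have "binomial_partial x (f * (1 - x)) (s + 1) (Suc N) n
      = (\<Sum>k<Suc N. ?b (s + 1) k * ?v k) - (\<Sum>k<Suc N. ?b (s + 1) k * ?v (Suc k))"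
    by (simp only: binomial_partial_def minus_arith.rep_eq right_diff_distrib sum_subtractf)
  \<comment> \<open>The term \<open>k = N\<close> contains \<open>x ^ Suc N\<close>, which vanishes
    below \<open>2 ^ Suc N\<close> and so at \<open>n\<close>.\<close>
  also have "(\<Sum>k<Suc N. ?b (s + 1) k * ?v (Suc k)) = (\<Sum>k<N. ?b (s + 1) k * ?v (Suc k))"
    using arith_val_mult_power_eq_0[OF assms(1), of n "Suc N" f] assms(2) by simp
  also have "(\<Sum>k<Suc N. ?b (s + 1) k * ?v k) - \<dots>
      = ?v 0 + (\<Sum>k<N. (?b (s + 1) (Suc k) - ?b (s + 1) k) * ?v (Suc k))"
    by (simp only: sum.lessThan_Suc_shift left_diff_distrib sum_subtractf) simp
  also have "\<dots> = binomial_partial x f s (Suc N) n"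
    unfolding pascal by (simp only: binomial_partial_def sum.lessThan_Suc_shift) simp
  finally show ?thesis .
qed

lemma arith_val_one_minus_moebius: "arith_val (1 - arith_of moebius) 1 = 0"
  by (simp add: minus_arith.rep_eq one_arith.rep_eq arith_val_arith_of conv_unit_def moebius_def)

lemma binomial_partial_moebius:
  assumes "n < 2 ^ N"
  shows "binomial_partial (1 - arith_of moebius) f s (Suc N) n
       = arith_val (f * arith_of (one_conv_power s)) n"
proof -
  \<comment> \<open>For \<open>x = 1 - arith_of moebius\<close>, simplification replaces
    \<open>1 - x\<close> by \<open>arith_of moebius\<close>.\<close>
  note step = binomial_partial_step[OF arith_val_one_minus_moebius assms, simplified]
  show ?thesis
  \<comment> \<open>The factor \<open>f\<close> stays arbitrary because the induction hypothesis is
    used for \<open>f * arith_of const_one\<close> going up and for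
    \<open>f * arith_of moebius\<close> going down.\<close>
  proof (induction s arbitrary: f rule: int_induct[of _ 0])
    case base
    then show ?case by (simp add: binomial_partial_0)
  next
    case (step1 i)
    have "f = f * arith_of const_one * arith_of moebius"
      using moebius_conv_one by (metis mult.assoc mult.commute mult_1_right)
    then show ?case
      using step[of "f * arith_of const_one" i] step1.IH one_conv_power_succ[of i]
      by (metis mult.assoc)
  next
    case (step2 i)
    then show ?case
      using step[of f "i - 1"] one_conv_power_pred[of i] by (simp add: mult.assoc)
  qed
qed

lemma binomial_series_moebius:
  "((\<lambda>k. ((of_int (int k + s - 1) :: complex) gchoose k)
          * arith_val (f * (1 - arith_of moebius) ^ k) n)
     has_sum arith_val (f * arith_of (one_conv_power s)) n) UNIV"
\<comment> \<open>Stopping at \<open>k = n\<close> is enough: \<open>n < 2 ^ n\<close> allows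
  \<open>N = n\<close> in \<open>binomial_partial_moebius\<close>, and all later terms vanish at
  \<open>n\<close>.\<close>
proof (rule has_sum_finite_neutralI[of "{..<Suc n}"])
  show "arith_val (f * arith_of (one_conv_power s)) n
      = (\<Sum>k<Suc n. ((of_int (int k + s - 1) :: complex) gchoose k)
          * arith_val (f * (1 - arith_of moebius) ^ k) n)"
    using binomial_partial_moebius[of n n f s] by (simp add: binomial_partial_def)
  fix k assume "k \<in> UNIV - {..<Suc n}"
  then have "n < 2 ^ k" using less_exp[of k] by (simp only: Diff_iff lessThan_iff) linarith
  then show "((of_int (int k + s - 1) :: complex) gchoose k)
          * arith_val (f * (1 - arith_of moebius) ^ k) n = 0"
    using arith_val_mult_power_eq_0[OF arith_val_one_minus_moebius] by simp
qed auto

section \<open>Associated divisor functions\<close>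

lemma arith_of_assoc_divisor_fun:
  "arith_of (assoc_divisor_fun k r)
     = (arith_of const_one - 1) ^ k * arith_of (one_conv_power r)"
  by (simp add: assoc_divisor_fun_def)

text \<open>Each step in \<open>k\<close> contributes one factor
  \<open>arith_of const_one - 1\<close> and one factor \<open>arith_of moebius\<close>, whose
  product is \<open>1 - arith_of moebius\<close> by inversion.\<close>

lemma arith_of_assoc_divisor_fun_shift:
  "arith_of (assoc_divisor_fun (u + k) (v - int k))
     = arith_of (assoc_divisor_fun u v) * (1 - arith_of moebius) ^ k"
proof -
  have "1 - arith_of moebius = (arith_of const_one - 1) * arith_of moebius"
    using moebius_conv_one by (simp add: algebra_simps)
  then show ?thesis
    by (simp add: arith_of_assoc_divisor_fun one_conv_power_diff_nat power_add power_mult_distrib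
        mult_ac)
qed

lemma assoc_divisor_fun_has_sum:
  assumes "n > 0"
  shows "((\<lambda>k. ((of_int (int k + r - 1) :: complex) gchoose (k - j))
            * assoc_divisor_fun (u + k) (v - int k) n)
          has_sum assoc_divisor_fun (j + u) (r + v) n) {j..}"
proof -
  \<comment> \<open>This is the function in the term \<open>k = j\<close>. Putting
    \<open>k = j + i\<close> turns \<open>k + r - 1\<close> into \<open>i + (j + r) - 1\<close>,
    hence the exponent \<open>j + r\<close> below.\<close>
  let ?f = "arith_of (assoc_divisor_fun (u + j) (v - int j))"
  have "?f * arith_of (one_conv_power (int j + r)) = arith_of (assoc_divisor_fun (j + u) (r + v))"
    using one_conv_power_add[of "v - int j" "int j + r"]
    by (simp add: arith_of_assoc_divisor_fun mult.assoc add_ac)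
  then have lim: "arith_val (?f * arith_of (one_conv_power (int j + r))) n
      = assoc_divisor_fun (j + u) (r + v) n"
    by (simp only: arith_val_arith_of[OF assms])
  have "?f * (1 - arith_of moebius) ^ i
      = arith_of (assoc_divisor_fun (u + (j + i)) (v - int (j + i)))" for i
    using arith_of_assoc_divisor_fun_shift[of "u + j" i "v - int j"]
    by (simp add: add.assoc diff_diff_eq)
  then have val: "arith_val (?f * (1 - arith_of moebius) ^ i) n
      = assoc_divisor_fun (u + (j + i)) (v - int (j + i)) n" for i
    by (simp only: arith_val_arith_of[OF assms])
  have bij: "bij_betw (\<lambda>i. j + i) UNIV {j..}"
    by (rule bij_betwI[of _ _ _ "\<lambda>k. k - j"]) auto
  show ?thesis
    using binomial_series_moebius[of "int j + r" ?f n] unfolding lim val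
    by (subst has_sum_reindex_bij_betw[OF bij, symmetric]) (simp add: add_ac)
qed

theorem theorem2:
  fixes j u :: nat and r v :: int
  shows "(\<forall>n>0. ((\<lambda>k::nat. ((of_int (int k + r - 1) :: complex) gchoose k)
                  * assoc_divisor_fun k (- int k) n)
           has_sum divisor_fun r n) UNIV)
       \<and> (\<forall>n>0. ((\<lambda>k::nat. ((of_int (int k + r - 1) :: complex) gchoose (k - j))
                  * assoc_divisor_fun (u + k) (v - int k) n)
           has_sum assoc_divisor_fun (j + u) (r + v) n) {j..})"
proof (intro conjI allI impI)
  fix n :: nat assume n: "n > 0"
  \<comment> \<open>The first series is the case \<open>j = u = v = 0\<close> of the general one;
    its sum has index 0, where the unit is convolved with \<open>one_conv_power r\<close>.\<close>
  have "assoc_divisor_fun 0 r n = divisor_fun r n"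
    using n by (simp add: assoc_divisor_fun_def divisor_fun_def dirichlet_conv_unit)
  then show "((\<lambda>k. ((of_int (int k + r - 1) :: complex) gchoose k)
                  * assoc_divisor_fun k (- int k) n) has_sum divisor_fun r n) UNIV"
    using assoc_divisor_fun_has_sum[OF n, of r 0 0 0] by simp
qed (rule assoc_divisor_fun_has_sum)

end
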